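(* Let $a,b$ be real numbers with $0\le a<b$ and let $\mathrm{C}_+[a,b]$ be the set of all continuous nonnegative real-valued functions on $I=[a,b]$, equipped with the metric $d(f,g)=\max_{t\in I}\{c(t)\}$, where for each $t\in I$ the nonnegative real number $c(t)$ is determined by $\max\{f(t),g(t)\}=\min\{f(t),g(t)\}+c(t)$. Then the metric space $(\mathrm{C}_+[a,b],d)$ is complete. *)

theory Defs
  imports "HOL-Analysis.Analysis"
begin

text \<open>Functions on \<open>[a, b]\<close> are represented extensionally (value \<open>undefined\<close> outside
  \<open>[a, b]\<close>), so that two elements agreeing on \<open>[a, b]\<close> are equal.\<close>

definition Cplus :: "real \<Rightarrow> real \<Rightarrow> (real \<Rightarrow> real) set" where
  "Cplus a b = {f \<in> {a..b} \<rightarrow>\<^sub>E {0..}. continuous_on {a..b} f}"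

definition gap :: "(real \<Rightarrow> real) \<Rightarrow> (real \<Rightarrow> real) \<Rightarrow> real \<Rightarrow> real" where
  "gap f g t = (THE c. 0 \<le> c \<and> max (f t) (g t) = min (f t) (g t) + c)"

text \<open>\<open>GREATEST\<close> denotes the maximum, i.e. the attained largest value. The library's \<open>Max\<close>
  is meant for finite sets only. The value 0 off \<open>Cplus a b\<close> is a junk value: the locale
  \<open>Metric_space\<close> requires nonnegativity and symmetry of the distance on the whole type.\<close>

definition dplus :: "real \<Rightarrow> real \<Rightarrow> (real \<Rightarrow> real) \<Rightarrow> (real \<Rightarrow> real) \<Rightarrow> real" where
  "dplus a b f g =
     (if f \<in> Cplus a b \<and> g \<in> Cplus a b then GREATEST m. m \<in> gap f g ` {a..b} else 0)"

end

theory Submission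
  imports Defs
begin

text \<open>Since max = min + c forces c = |f(t) - g(t)|, the distance is the supremum metric in
  disguise. By \<open>dplus_is_max\<close> it is an attained maximum dominating every pointwise
  difference, so the metric axioms reduce to those of the real line. For completeness, a Cauchy
  sequence is uniformly Cauchy, hence has a uniform limit; continuity and nonnegativity pass to that
  limit, and uniform convergence is convergence in \<open>dplus\<close>.\<close>

lemma gap_eq_abs_diff: "gap f g t = \<bar>f t - g t\<bar>"
  unfolding gap_def by (rule the_equality) (auto simp: max_def min_def split: if_splits)

text \<open>\<open>GREATEST\<close> is meaningful only if a largest value exists; compactness of the
  nonempty interval and continuity of |f - g| supply it. All later reasoning about
  \<open>dplus\<close> on \<open>Cplus\<close> goes through these two facts.\<close>

lemma dplus_is_max:
  assumes "a \<le> b" "f \<in> Cplus a b" "g \<in> Cplus a b"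
  shows dplus_attained: "\<exists>t\<in>{a..b}. dplus a b f g = \<bar>f t - g t\<bar>"
    and abs_diff_le_dplus: "\<And>t. t \<in> {a..b} \<Longrightarrow> \<bar>f t - g t\<bar> \<le> dplus a b f g"
proof -
  have "continuous_on {a..b} (\<lambda>t. \<bar>f t - g t\<bar>)"
    using assms by (auto simp: Cplus_def intro!: continuous_intros)
  then obtain s where s: "s \<in> {a..b}" "\<forall>t\<in>{a..b}. \<bar>f t - g t\<bar> \<le> \<bar>f s - g s\<bar>"
    using continuous_attains_sup[of "{a..b}"] \<open>a \<le> b\<close> by force
  then have "(GREATEST m. m \<in> gap f g ` {a..b}) = \<bar>f s - g s\<bar>"
    by (intro Greatest_equality) (auto simp: gap_eq_abs_diff)
  then have "dplus a b f g = \<bar>f s - g s\<bar>"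
    using assms by (simp add: dplus_def)
  with s show "\<exists>t\<in>{a..b}. dplus a b f g = \<bar>f t - g t\<bar>"
    and "\<And>t. t \<in> {a..b} \<Longrightarrow> \<bar>f t - g t\<bar> \<le> dplus a b f g"
    by auto
qed

lemma Metric_space_Cplus:
  assumes "a \<le> b"
  shows "Metric_space (Cplus a b) (dplus a b)"
proof
  fix f g
  show "0 \<le> dplus a b f g"
    using dplus_attained[OF assms, of f g]
    by (cases "f \<in> Cplus a b \<and> g \<in> Cplus a b") (auto simp: dplus_def)
  have "gap f g = gap g f"
    by (simp add: fun_eq_iff gap_eq_abs_diff abs_minus_commute)
  then show "dplus a b f g = dplus a b g f"
    by (auto simp: dplus_def)
next
  fix f g assume fg: "f \<in> Cplus a b" "g \<in> Cplus a b"
  show "dplus a b f g = 0 \<longleftrightarrow> f = g"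
  proof
    assume "dplus a b f g = 0"
    then have "f t = g t" if "t \<in> {a..b}" for t
      using abs_diff_le_dplus[OF assms fg that] by simp
    \<comment> \<open>Agreement on the interval suffices because members of \<open>Cplus\<close> are
      extensional.\<close>
    with fg show "f = g"
      unfolding Cplus_def by (blast intro: PiE_ext)
  next
    assume "f = g"
    then show "dplus a b f g = 0"
      using dplus_attained[OF assms fg] by auto
  qed
next
  fix f g h assume fgh: "f \<in> Cplus a b" "g \<in> Cplus a b" "h \<in> Cplus a b"
  \<comment> \<open>At a point where |f - h| is maximal, the real triangle inequality gives the
    claim.\<close>
  obtain t where t: "t \<in> {a..b}" "dplus a b f h = \<bar>f t - h t\<bar>"
    using dplus_attained[OF assms] fgh by blast
  then show "dplus a b f h \<le> dplus a b f g + dplus a b g h"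
    using abs_diff_le_dplus[OF assms fgh(1,2) t(1)] abs_diff_le_dplus[OF assms fgh(2,3) t(1)]
    by linarith
qed

lemma mcomplete_Cplus:
  assumes "a \<le> b"
  shows "Metric_space.mcomplete (Cplus a b) (dplus a b)"
proof -
  interpret Metric_space "Cplus a b" "dplus a b"
    using assms by (rule Metric_space_Cplus)
  show ?thesis
    unfolding mcomplete_def
  proof (intro allI impI)
    fix \<sigma> assume \<sigma>: "MCauchy \<sigma>"
    then have mem: "\<sigma> n \<in> Cplus a b" for n
      by (auto simp: MCauchy_def)
    have "uniformly_Cauchy_on {a..b} \<sigma>"
    proof (rule uniformly_Cauchy_onI)
      fix e :: real assume "e > 0"
      with \<sigma> obtain N where N: "\<And>m n. N \<le> m \<Longrightarrow> N \<le> n \<Longrightarrow> dplus a b (\<sigma> m) (\<sigma> n) < e"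
        unfolding MCauchy_def by blast
      \<comment> \<open>The index \<open>N\<close> comes from the distance, so it serves all
        \<open>t\<close> at once.\<close>
      have "dist (\<sigma> m t) (\<sigma> n t) < e" if "t \<in> {a..b}" "N \<le> m" "N \<le> n" for t m n
        using abs_diff_le_dplus[OF assms mem mem that(1)] N[OF that(2,3)]
        unfolding dist_real_def by (rule le_less_trans)
      then show "\<exists>M. \<forall>t\<in>{a..b}. \<forall>m\<ge>M. \<forall>n\<ge>M. dist (\<sigma> m t) (\<sigma> n t) < e"
        by blast
    qed
    then obtain l where l: "uniform_limit {a..b} \<sigma> l sequentially"
      using Cauchy_uniformly_convergent unfolding uniformly_convergent_on_def by blast
    \<comment> \<open>Uniform convergence leaves \<open>l\<close> arbitrary off the interval;
      restricting it gives the extensional representative that \<open>Cplus\<close> demands.\<close>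
    define f where "f = restrict l {a..b}"
    have lim: "uniform_limit {a..b} \<sigma> f sequentially"
      using l by (rule uniform_limit_cong'[THEN iffD1, rotated 2]) (simp_all add: f_def)
    have "0 \<le> f t" if "t \<in> {a..b}" for t
    proof (rule LIMSEQ_le_const)
      show "(\<lambda>n. \<sigma> n t) \<longlonglongrightarrow> f t"
        using lim that by (rule tendsto_uniform_limitI)
      show "\<exists>N. \<forall>n\<ge>N. 0 \<le> \<sigma> n t"
        using mem that by (fastforce simp: Cplus_def)
    qed
    moreover have "continuous_on {a..b} f"
      using mem by (intro uniform_limit_theorem[OF _ lim]) (auto simp: Cplus_def)
    ultimately have f: "f \<in> Cplus a b"
      by (auto simp: Cplus_def f_def)
    have "limitin mtopology \<sigma> f sequentially"
      unfolding limitin_metric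
    proof (intro conjI allI impI f)
      fix e :: real assume "e > 0"
      then have "\<forall>\<^sub>F n in sequentially. \<forall>t\<in>{a..b}. dist (\<sigma> n t) (f t) < e"
        using lim by (rule uniform_limitD[rotated])
      then show "\<forall>\<^sub>F n in sequentially. \<sigma> n \<in> Cplus a b \<and> dplus a b (\<sigma> n) f < e"
      proof (rule eventually_mono)
        fix n assume "\<forall>t\<in>{a..b}. dist (\<sigma> n t) (f t) < e"
        then show "\<sigma> n \<in> Cplus a b \<and> dplus a b (\<sigma> n) f < e"
          \<comment> \<open>The strict pointwise bound survives because the maximum is attained; a
            mere supremum would only give \<le> \<open>e\<close>.\<close>
          using dplus_attained[OF assms mem f, of n] mem by (auto simp: dist_real_def)
      qed
    qed
    then show "\<exists>x. limitin mtopology \<sigma> x sequentially"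
      by blast
  qed
qed

theorem theorem3p7:
  fixes a b :: real
  assumes "0 \<le> a" and "a < b"
  shows "Metric_space (Cplus a b) (dplus a b) \<and> Metric_space.mcomplete (Cplus a b) (dplus a b)"
  using Metric_space_Cplus mcomplete_Cplus assms by simp

end
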